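(* For a function $I:[0,1]^2\to[0,1]$, put $N_I(x)=I(x,0)$ for $x\in[0,1]$. The following statements are equivalent: (i) $I$ is a $(D,N)$-implication in which $N$ is a continuous fuzzy negation and $D$ is a fuzzy disjunction with a right neutral element $0$; that is, there exist a continuous fuzzy negation $N$ and a fuzzy disjunction $D$ with right neutral element $0$ such that $I(x,y)=D(N(x),y)$ for all $x,y\in[0,1]$. (ii) $I$ is a fuzzy implication, $N_I$ is a continuous fuzzy negation, and for all $x_1,x_2\in[0,1]$ with $N_I(x_1)=N_I(x_2)$ one has $I(x_1,y)=I(x_2,y)$ for every $y\in[0,1]$. Moreover, in this case the representation $I(x,y)=D(N(x),y)$ is unique: if $N_1,N_2$ are continuous fuzzy negations and $D_1,D_2$ are fuzzy disjunctions with right neutral element $0$ such that $I(x,y)=D_1(N_1(x),y)=D_2(N_2(x),y)$ for all $x,y\in[0,1]$, then $N_1=N_2$ and $D_1=D_2$.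
   Context: A fuzzy disjunction is a function $D:[0,1]^2\to[0,1]$ that is non-decreasing in each variable and satisfies $D(0,0)=0$ and $D(1,1)=D(1,0)=D(0,1)=1$. It has right neutral element $0$ if $D(x,0)=x$ for all $x\in[0,1]$. A fuzzy negation is a non-increasing function $N:[0,1]\to[0,1]$ with $N(0)=1$ and $N(1)=0$. A fuzzy implication is a function $I:[0,1]^2\to[0,1]$ that is non-increasing in its first variable, non-decreasing in its second variable, and satisfies $I(0,0)=1$, $I(1,1)=1$, $I(1,0)=0$. A function $I:[0,1]^2\to[0,1]$ is called a $(D,N)$-implication if there exist a fuzzy disjunction $D$ and a fuzzy negation $N$ such that $I(x,y)=D(N(x),y)$ for all $x,y\in[0,1]$. *)

theory Defs
  imports "HOL-Analysis.Analysis" "HOL-Library.FuncSet"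
begin

text \<open>
  Functions on the unit interval and on the unit square are represented by total functions on
  the reals, binary ones in curried form. Only their values at arguments in \<open>[0,1]\<close> are
  constrained, and equality of two such functions means equality at all arguments in \<open>[0,1]\<close>.
\<close>

abbreviation unit_interval :: "real set" where
  "unit_interval \<equiv> {0..1}"

definition fuzzy_disjunction :: "(real \<Rightarrow> real \<Rightarrow> real) \<Rightarrow> bool" where
  "fuzzy_disjunction D \<longleftrightarrow>
     D \<in> unit_interval \<rightarrow> unit_interval \<rightarrow> unit_interval \<and>
     (\<forall>y\<in>unit_interval. mono_on unit_interval (\<lambda>x. D x y)) \<and>
     (\<forall>x\<in>unit_interval. mono_on unit_interval (\<lambda>y. D x y)) \<and>
     D 0 0 = 0 \<and> D 1 1 = 1 \<and> D 1 0 = 1 \<and> D 0 1 = 1"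

definition right_neutral_zero :: "(real \<Rightarrow> real \<Rightarrow> real) \<Rightarrow> bool" where
  "right_neutral_zero D \<longleftrightarrow> (\<forall>x\<in>unit_interval. D x 0 = x)"

definition fuzzy_negation :: "(real \<Rightarrow> real) \<Rightarrow> bool" where
  "fuzzy_negation N \<longleftrightarrow>
     N \<in> unit_interval \<rightarrow> unit_interval \<and>
     antimono_on unit_interval N \<and> N 0 = 1 \<and> N 1 = 0"

definition continuous_fuzzy_negation :: "(real \<Rightarrow> real) \<Rightarrow> bool" where
  "continuous_fuzzy_negation N \<longleftrightarrow> fuzzy_negation N \<and> continuous_on unit_interval N"

definition fuzzy_implication :: "(real \<Rightarrow> real \<Rightarrow> real) \<Rightarrow> bool" where
  "fuzzy_implication I \<longleftrightarrow>
     I \<in> unit_interval \<rightarrow> unit_interval \<rightarrow> unit_interval \<and>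
     (\<forall>y\<in>unit_interval. antimono_on unit_interval (\<lambda>x. I x y)) \<and>
     (\<forall>x\<in>unit_interval. mono_on unit_interval (\<lambda>y. I x y)) \<and>
     I 0 0 = 1 \<and> I 1 1 = 1 \<and> I 1 0 = 0"

definition DN_implication_with ::
    "(real \<Rightarrow> real \<Rightarrow> real) \<Rightarrow> (real \<Rightarrow> real) \<Rightarrow> (real \<Rightarrow> real \<Rightarrow> real) \<Rightarrow> bool" where
  "DN_implication_with D N I \<longleftrightarrow>
     fuzzy_disjunction D \<and> fuzzy_negation N \<and>
     (\<forall>x\<in>unit_interval. \<forall>y\<in>unit_interval. I x y = D (N x) y)"

definition natural_negation :: "(real \<Rightarrow> real \<Rightarrow> real) \<Rightarrow> real \<Rightarrow> real" where
  "natural_negation I x = I x 0"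

end

theory Submission imports Defs begin

text \<open>
  If \<open>0\<close> is right neutral for \<open>D\<close> and \<open>I x y = D (N x) y\<close>, then \<open>I x 0 = D (N x) 0 = N x\<close>, so
  the negation is forced to be \<^term>\<open>natural_negation I\<close>. It is continuous and goes from \<open>1\<close>
  to \<open>0\<close>, hence maps \<open>[0,1]\<close> onto \<open>[0,1]\<close>; every first argument of \<open>D\<close> is therefore some
  \<open>N x\<close>, and \<open>D\<close> is determined by \<open>I\<close> as well. This is uniqueness.

  For existence, the condition that \<open>I x y\<close> depends on \<open>x\<close> only through \<open>I x 0\<close> makes
  \<open>D u y = I x y\<close>, for any \<open>x\<close> with \<open>I x 0 = u\<close>, well defined. An antitone \<open>N\<close> with
  \<open>N a < N b\<close> has \<open>b < a\<close>, so \<open>D\<close> inherits monotonicity in its first argument from the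
  antitonicity of \<open>I\<close>.
\<close>

lemma fuzzy_negation_in_unit:
  assumes "fuzzy_negation N" "x \<in> unit_interval"
  shows "N x \<in> unit_interval"
  using assms by (simp add: fuzzy_negation_def Pi_iff)

lemma continuous_fuzzy_negation_surj:
  assumes "continuous_fuzzy_negation N"
  shows "N ` unit_interval = unit_interval"
proof
  have neg: "fuzzy_negation N" and cont: "continuous_on unit_interval N"
    using assms by (auto simp: continuous_fuzzy_negation_def)
  show "N ` unit_interval \<subseteq> unit_interval"
    using fuzzy_negation_in_unit[OF neg] by blast
  show "unit_interval \<subseteq> N ` unit_interval"
  proof
    fix u :: real
    assume "u \<in> unit_interval"
    then have "\<exists>x\<ge>0. x \<le> 1 \<and> N x = u"
      using neg cont by (intro IVT2') (auto simp: fuzzy_negation_def)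
    then show "u \<in> N ` unit_interval" by auto
  qed
qed

lemma continuous_fuzzy_negation_cong:
  assumes "\<And>x. x \<in> unit_interval \<Longrightarrow> M x = N x"
  shows "continuous_fuzzy_negation M \<longleftrightarrow> continuous_fuzzy_negation N"
proof -
  have "continuous_on unit_interval M \<longleftrightarrow> continuous_on unit_interval N"
    using assms by (intro continuous_on_cong) auto
  moreover have "fuzzy_negation M \<longleftrightarrow> fuzzy_negation N"
    using assms by (simp add: fuzzy_negation_def Pi_iff monotone_on_def)
  ultimately show ?thesis by (simp add: continuous_fuzzy_negation_def)
qed

lemma DN_implication_eq:
  assumes "DN_implication_with D N I" "x \<in> unit_interval" "y \<in> unit_interval"
  shows "I x y = D (N x) y"
  using assms unfolding DN_implication_with_def by blast

lemma DN_implication_natural_negation: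
  assumes "right_neutral_zero D" "DN_implication_with D N I" "x \<in> unit_interval"
  shows "natural_negation I x = N x"
proof -
  have "N x \<in> unit_interval"
    using assms fuzzy_negation_in_unit by (simp add: DN_implication_with_def)
  then show ?thesis
    using assms DN_implication_eq[OF assms(2,3), of 0]
    by (simp add: natural_negation_def right_neutral_zero_def)
qed

lemma DN_implication_unique:
  assumes "continuous_fuzzy_negation N1" "right_neutral_zero D1" "DN_implication_with D1 N1 I"
    and "right_neutral_zero D2" "DN_implication_with D2 N2 I"
  shows "\<forall>x\<in>unit_interval. N1 x = N2 x"
    and "\<forall>x\<in>unit_interval. \<forall>y\<in>unit_interval. D1 x y = D2 x y"
proof -
  show eq: "\<forall>x\<in>unit_interval. N1 x = N2 x"
    using assms DN_implication_natural_negation by metis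
  show "\<forall>x\<in>unit_interval. \<forall>y\<in>unit_interval. D1 x y = D2 x y"
  proof (intro ballI)
    fix u y :: real
    assume u: "u \<in> unit_interval" and y: "y \<in> unit_interval"
    then obtain x where x: "x \<in> unit_interval" "u = N1 x"
      using continuous_fuzzy_negation_surj[OF assms(1)] by blast
    show "D1 u y = D2 u y"
      using DN_implication_eq[OF assms(3) x(1) y] DN_implication_eq[OF assms(5) x(1) y] eq x
      by simp
  qed
qed

lemma DN_implication_fuzzy_implication:
  assumes I: "I \<in> unit_interval \<rightarrow> unit_interval \<rightarrow> unit_interval"
    and DN: "DN_implication_with D N I"
  shows "fuzzy_implication I"
proof -
  have D: "fuzzy_disjunction D" and N: "fuzzy_negation N"
    using DN by (auto simp: DN_implication_with_def)
  note eq = DN_implication_eq[OF DN] and N_in = fuzzy_negation_in_unit[OF N]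
  have "antimono_on unit_interval (\<lambda>x. I x y)" if y: "y \<in> unit_interval" for y
  proof (rule monotone_onI)
    fix a b :: real
    assume ab: "a \<in> unit_interval" "b \<in> unit_interval" "a \<le> b"
    have "N b \<le> N a"
      using N ab unfolding fuzzy_negation_def by (meson monotone_onD)
    then have "D (N b) y \<le> D (N a) y"
      using D y N_in[OF ab(1)] N_in[OF ab(2)] unfolding fuzzy_disjunction_def
      by (meson monotone_onD)
    then show "I b y \<le> I a y" using eq ab y by simp
  qed
  moreover have "mono_on unit_interval (\<lambda>y. I x y)" if x: "x \<in> unit_interval" for x
  proof (rule monotone_onI)
    fix a b :: real
    assume ab: "a \<in> unit_interval" "b \<in> unit_interval" "a \<le> b"
    have "D (N x) a \<le> D (N x) b"
      using D N_in[OF x] ab unfolding fuzzy_disjunction_def by (meson monotone_onD)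
    then show "I x a \<le> I x b" using eq x ab by simp
  qed
  moreover have "I 0 0 = 1" "I 1 1 = 1" "I 1 0 = 0"
    using eq[of 0 0] eq[of 1 1] eq[of 1 0] D N
    by (simp_all add: fuzzy_disjunction_def fuzzy_negation_def)
  ultimately show ?thesis using I by (simp add: fuzzy_implication_def)
qed

text \<open>
  The witness is \<open>D u y = I x y\<close> for a chosen \<open>x\<close> in \<open>[0,1]\<close> with \<open>I x 0 = u\<close>.
\<close>
lemma DN_implication_exists:
  assumes imp: "fuzzy_implication I"
    and cont: "continuous_fuzzy_negation (natural_negation I)"
    and well: "\<And>x1 x2 y. \<lbrakk>x1 \<in> unit_interval; x2 \<in> unit_interval; y \<in> unit_interval;
                 natural_negation I x1 = natural_negation I x2\<rbrakk> \<Longrightarrow> I x1 y = I x2 y"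
  obtains D where "right_neutral_zero D" "DN_implication_with D (natural_negation I) I"
proof -
  define N where "N = natural_negation I"
  define g where "g = inv_into unit_interval N"
  define D where "D = (\<lambda>u. I (g u))"
  have neg: "fuzzy_negation N"
    using cont by (simp add: N_def continuous_fuzzy_negation_def)
  have surj: "N ` unit_interval = unit_interval"
    using continuous_fuzzy_negation_surj cont by (simp add: N_def)
  have g_in: "g u \<in> unit_interval" and N_g: "N (g u) = u" if "u \<in> unit_interval" for u
    using that surj inv_into_into[of u N unit_interval] f_inv_into_f[of u N unit_interval]
    unfolding g_def by blast+
  have D_N: "D (N x) y = I x y" if "x \<in> unit_interval" "y \<in> unit_interval" for x y
  proof -
    have "N x \<in> unit_interval" using fuzzy_negation_in_unit[OF neg that(1)] .
    then show ?thesis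
      unfolding D_def using well[of "g (N x)" x y] g_in N_g that by (simp add: N_def)
  qed
  have mono_fst: "mono_on unit_interval (\<lambda>u. D u y)" if y: "y \<in> unit_interval" for y
  proof (rule monotone_onI)
    fix u v :: real
    assume uv: "u \<in> unit_interval" "v \<in> unit_interval" "u \<le> v"
    show "D u y \<le> D v y"
    proof (cases "u = v")
      case False
      have "g v \<le> g u"
      proof (rule ccontr)
        assume "\<not> g v \<le> g u"
        then have "N (g v) \<le> N (g u)"
          using neg g_in[OF uv(1)] g_in[OF uv(2)] unfolding fuzzy_negation_def
          by (meson linear monotone_onD)
        then show False using N_g uv False by simp
      qed
      then show ?thesis
        using imp y g_in[OF uv(1)] g_in[OF uv(2)] unfolding D_def fuzzy_implication_def
        by (meson monotone_onD)
    qed simp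
  qed
  have "antimono_on unit_interval (\<lambda>x. I x 1)"
    using imp by (simp add: fuzzy_implication_def)
  then have "I 1 1 \<le> I 0 1"
    by (rule monotone_onD) simp_all
  moreover have "I 0 1 \<in> unit_interval"
    using imp by (auto simp: fuzzy_implication_def Pi_iff)
  ultimately have "I 0 1 = 1"
    using imp by (simp add: fuzzy_implication_def)
  then have corners: "D 0 0 = 0" "D 1 1 = 1" "D 1 0 = 1" "D 0 1 = 1"
    using D_N[of 1 0] D_N[of 0 1] D_N[of 0 0] D_N[of 1 1] neg imp
    by (simp_all add: fuzzy_negation_def fuzzy_implication_def)
  have "D \<in> unit_interval \<rightarrow> unit_interval \<rightarrow> unit_interval"
    using imp g_in unfolding D_def fuzzy_implication_def by (simp only: Pi_iff) blast
  moreover have "\<forall>u\<in>unit_interval. mono_on unit_interval (\<lambda>y. D u y)"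
    using imp g_in unfolding D_def fuzzy_implication_def by blast
  ultimately have "fuzzy_disjunction D"
    using mono_fst corners by (simp add: fuzzy_disjunction_def)
  then have "DN_implication_with D (natural_negation I) I"
    using neg D_N by (simp add: DN_implication_with_def N_def)
  moreover have "right_neutral_zero D"
    using N_g by (simp add: right_neutral_zero_def D_def N_def natural_negation_def)
  ultimately show thesis using that by blast
qed

theorem theorem4p1:
  fixes I :: "real \<Rightarrow> real \<Rightarrow> real"
  assumes "I \<in> unit_interval \<rightarrow> unit_interval \<rightarrow> unit_interval"
  shows "((\<exists>N D. continuous_fuzzy_negation N \<and> right_neutral_zero D \<and> DN_implication_with D N I)
          \<longleftrightarrow>
          (fuzzy_implication I \<and> continuous_fuzzy_negation (natural_negation I) \<and>
           (\<forall>x1\<in>unit_interval. \<forall>x2\<in>unit_interval.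
              natural_negation I x1 = natural_negation I x2 \<longrightarrow>
              (\<forall>y\<in>unit_interval. I x1 y = I x2 y))))
         \<and>
         (\<forall>N1 N2 D1 D2.
            continuous_fuzzy_negation N1 \<and> right_neutral_zero D1 \<and> DN_implication_with D1 N1 I \<and>
            continuous_fuzzy_negation N2 \<and> right_neutral_zero D2 \<and> DN_implication_with D2 N2 I \<longrightarrow>
            (\<forall>x\<in>unit_interval. N1 x = N2 x) \<and>
            (\<forall>x\<in>unit_interval. \<forall>y\<in>unit_interval. D1 x y = D2 x y))"
    (is "(?i \<longleftrightarrow> ?ii) \<and> ?unique")
proof (intro conjI iffI)
  assume ?i
  then obtain N D where N: "continuous_fuzzy_negation N"
    and D: "right_neutral_zero D" and DN: "DN_implication_with D N I"
    by blast
  note nat = DN_implication_natural_negation[OF D DN]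
  show "fuzzy_implication I" using DN_implication_fuzzy_implication[OF assms DN] .
  show "continuous_fuzzy_negation (natural_negation I)"
    using N continuous_fuzzy_negation_cong[of "natural_negation I" N] nat by simp
  show "\<forall>x1\<in>unit_interval. \<forall>x2\<in>unit_interval.
          natural_negation I x1 = natural_negation I x2 \<longrightarrow>
          (\<forall>y\<in>unit_interval. I x1 y = I x2 y)"
  proof (intro ballI impI)
    fix x1 x2 y :: real
    assume x: "x1 \<in> unit_interval" "x2 \<in> unit_interval" and y: "y \<in> unit_interval"
      and "natural_negation I x1 = natural_negation I x2"
    then have "N x1 = N x2" using nat by simp
    then show "I x1 y = I x2 y"
      using DN_implication_eq[OF DN x(1) y] DN_implication_eq[OF DN x(2) y] by simp
  qed
next
  assume ii: ?ii
  then have imp: "fuzzy_implication I"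
    and cont: "continuous_fuzzy_negation (natural_negation I)"
    by simp_all
  have well: "I x1 y = I x2 y"
    if "x1 \<in> unit_interval" "x2 \<in> unit_interval" "y \<in> unit_interval"
      "natural_negation I x1 = natural_negation I x2" for x1 x2 y
    using ii that by blast
  obtain D where "right_neutral_zero D" "DN_implication_with D (natural_negation I) I"
    using DN_implication_exists[OF imp cont well] .
  with cont show ?i by blast
next
  show ?unique
  proof (intro allI impI, elim conjE)
    fix N1 N2 D1 D2
    assume 1: "continuous_fuzzy_negation N1" "right_neutral_zero D1" "DN_implication_with D1 N1 I"
      and 2: "right_neutral_zero D2" "DN_implication_with D2 N2 I"
    show "(\<forall>x\<in>unit_interval. N1 x = N2 x) \<and>
          (\<forall>x\<in>unit_interval. \<forall>y\<in>unit_interval. D1 x y = D2 x y)"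
      using DN_implication_unique[OF 1 2] by (rule conjI)
  qed
qed

end
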